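(* Let $a,b,t,x$ be complex numbers with $t\neq0$ and $b\notin\{0,-1,-2,\dots\}$. Then $$\sum _{k=0}^{\infty } \frac{(b-a)_k\, t^k \, {}_1F_1(a;b+k;x)}{(k+1)!\,(b)_k}=\frac{1}{t}\int_0^t e^{s} \, {}_1F_1(a;b;x-s)\, ds .$$
   Context: ${}_1F_1$ is the Kummer confluent hypergeometric function and $(c)_k=c(c+1)\cdots(c+k-1)$, $(c)_0=1$, is the Pochhammer symbol. *)

theory Defs
  imports "HOL-Complex_Analysis.Complex_Analysis"
begin

text \<open>
  Kummer's confluent hypergeometric function
  \<open>\<^sub>1F\<^sub>1(a; b; z) = \<Sum>n. (a)\<^sub>n z\<^sup>n / ((b)\<^sub>n n!)\<close>.
  It is meaningful only for \<open>b \<notin> \<int>\<^sub>\<le>\<^sub>0\<close>; for other \<open>b\<close> some denominators vanish and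
  division by zero gives junk values. The Pochhammer symbol \<open>(c)\<^sub>k\<close> is
  \<^term>\<open>pochhammer c k\<close>.
\<close>

definition hypergeo_1F1 :: "complex \<Rightarrow> complex \<Rightarrow> complex \<Rightarrow> complex" where
  "hypergeo_1F1 a b z = (\<Sum>n. pochhammer a n / (pochhammer b n * fact n) * z ^ n)"

lemma hypergeo_1F1_altdef: "hypergeo_1F1 a b z = eval_fps (fps_hypergeo [a] [b] 1) z"
  by (simp add: hypergeo_1F1_def eval_fps_def)

lemma hypergeo_1F1_sums:
  assumes b: "b \<notin> \<int>\<^sub>\<le>\<^sub>0"
  shows "(\<lambda>n. pochhammer a n / (pochhammer b n * fact n) * z ^ n) sums hypergeo_1F1 a b z"
proof -
  define f where "f = (\<lambda>n. pochhammer a n / (pochhammer b n * fact n) * z ^ n)"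
  define r where "r = (\<lambda>n. (1 + (a - b) / (b + of_nat n)) * (z / of_nat (Suc n)))"
  have nz: "b + of_nat n \<noteq> 0" for n
    using b plus_of_nat_eq_0_imp by blast
  have f_Suc: "f (Suc n) = r n * f n" for n
  proof -
    have "1 + (a - b) / (b + of_nat n) = (a + of_nat n) / (b + of_nat n)"
      using nz[of n] by (simp add: field_simps)
    thus ?thesis
      by (simp add: f_def r_def pochhammer_Suc mult_ac)
  qed
  have inf: "filterlim (\<lambda>n. b + of_nat n) at_infinity sequentially"
    by (intro tendsto_add_filterlim_at_infinity[OF tendsto_const] tendsto_of_nat)
  have inf': "filterlim (\<lambda>n. of_nat (Suc n) :: complex) at_infinity sequentially"
    using tendsto_of_nat by (rule filterlim_compose) (rule filterlim_Suc)
  have "r \<longlonglongrightarrow> (1 + 0) * 0"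
    unfolding r_def
    by (intro tendsto_mult tendsto_add tendsto_const
          tendsto_divide_0[OF tendsto_const inf] tendsto_divide_0[OF tendsto_const inf'])
  hence "(\<lambda>n. norm (r n)) \<longlonglongrightarrow> 0"
    by (simp add: tendsto_norm_zero)
  hence "eventually (\<lambda>n. norm (r n) < 1 / 2) sequentially"
    by (rule order_tendstoD) simp
  then obtain N where N: "norm (r n) < 1 / 2" if "n \<ge> N" for n
    by (auto simp: eventually_at_top_linorder)
  have "summable f"
  proof (rule summable_ratio_test)
    show "norm (f (Suc n)) \<le> 1 / 2 * norm (f n)" if "n \<ge> N" for n
      unfolding f_Suc norm_mult using N[OF that] by (intro mult_right_mono) auto
  qed simp
  thus ?thesis
    unfolding f_def hypergeo_1F1_def by (rule summable_sums)
qed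

end

theory Submission
  imports Defs
begin

text \<open>
  The series is a Taylor expansion. Put \<open>g s = e\<^sup>s \<^sub>1F\<^sub>1(a; b; x - s)\<close>. Comparing coefficients gives the
  contiguous relation \<open>\<^sub>1F\<^sub>1(a; b; z) - \<^sub>1F\<^sub>1'(a; b; z) = (b - a)/b \<^sub>1F\<^sub>1(a; b + 1; z)\<close>, and hence
  \<open>g' s = (b - a)/b e\<^sup>s \<^sub>1F\<^sub>1(a; b + 1; x - s)\<close>: differentiation reproduces the shape of \<open>g\<close> with \<open>b\<close>
  raised by one. Iterating, the \<open>k\<close>-th derivative of \<open>g\<close> at 0 is
  \<open>(b - a)\<^sub>k / (b)\<^sub>k \<^sub>1F\<^sub>1(a; b + k; x)\<close>.

  The function \<open>g\<close> is entire, so it has an entire primitive \<open>G\<close>, whose increment \<open>G t - G 0\<close> is the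
  integral of \<open>g\<close> from 0 to \<open>t\<close>. The Taylor series of \<open>G\<close> at 0 without its constant term, divided by
  \<open>t\<close>, has the terms \<open>g\<^sup>(\<^sup>k\<^sup>)(0) t\<^sup>k / (k + 1)!\<close>, and these are the terms of the claim. Working with
  \<open>G\<close> instead of \<open>g\<close> avoids a separate justification of termwise integration.
\<close>

lemma nonpos_Ints_plus_of_nat:
  fixes b :: complex
  assumes "b \<notin> \<int>\<^sub>\<le>\<^sub>0"
  shows "b + of_nat k \<notin> \<int>\<^sub>\<le>\<^sub>0"
proof
  assume "b + of_nat k \<in> \<int>\<^sub>\<le>\<^sub>0"
  then obtain n where "b + of_nat k = - of_nat n"
    by (elim nonpos_Ints_cases')
  hence "b = - of_nat (n + k)"
    by (simp add: algebra_simps eq_neg_iff_add_eq_0)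
  with assms show False
    by (metis minus_of_nat_in_nonpos_Ints)
qed

text \<open>
  The derivative is expressed through \<open>b + 1\<close> alone, rather than as
  \<open>a/b \<^sub>1F\<^sub>1(a + 1; b + 1; z)\<close>, so that the first summand cancels when the product
  \<open>e\<^sup>s \<^sub>1F\<^sub>1(a; b; x - s)\<close> is differentiated. The coefficientwise reason is \<open>1 - (a + n)/(b + n) = (b - a)/(b + n)\<close> together with
  \<open>(b)\<^sub>n (b + n) = b (b + 1)\<^sub>n\<close>.
\<close>
lemma has_field_derivative_hypergeo_1F1:
  assumes b: "b \<notin> \<int>\<^sub>\<le>\<^sub>0"
  shows "(hypergeo_1F1 a b has_field_derivative
           (hypergeo_1F1 a b z - (b - a) / b * hypergeo_1F1 a (b + 1) z)) (at z)"
proof -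
  define c where "c = (\<lambda>n. pochhammer a n / (pochhammer b n * fact n))"
  define c1 where "c1 = (\<lambda>n. pochhammer a n / (pochhammer (b + 1) n * fact n))"
  have b1: "b + 1 \<notin> \<int>\<^sub>\<le>\<^sub>0"
    using nonpos_Ints_plus_of_nat[OF b, of 1] by simp
  have coeff: "diffs c n = c n - (b - a) / b * c1 n" for n
  proof -
    have nz: "b \<noteq> 0" "b + of_nat n \<noteq> 0" "pochhammer b n \<noteq> 0" "pochhammer (b + 1) n \<noteq> 0"
      using b b1 plus_of_nat_eq_0_imp[of b n] pochhammer_eq_0_imp_nonpos_Int by auto
    have rec: "b * pochhammer (b + 1) n = pochhammer b n * (b + of_nat n)"
      by (metis pochhammer_rec pochhammer_Suc)
    have "diffs c n = c n * ((a + of_nat n) / (b + of_nat n))"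
      using of_nat_neq_0[of n, where ?'a = complex]
      by (simp add: diffs_def c_def pochhammer_Suc del: of_nat_Suc)
    also have "(a + of_nat n) / (b + of_nat n) = 1 - (b - a) / (b + of_nat n)"
      using nz by (simp add: field_simps)
    also have "c n * (1 - (b - a) / (b + of_nat n)) =
                 c n - (b - a) * pochhammer a n / (pochhammer b n * (b + of_nat n) * fact n)"
      unfolding right_diff_distrib by (simp add: c_def mult_ac)
    also have "\<dots> = c n - (b - a) / b * c1 n"
      by (simp add: c1_def mult_ac flip: rec)
    finally show ?thesis .
  qed
  have sums: "(\<lambda>n. c n * y ^ n) sums hypergeo_1F1 a b y" for y
    unfolding c_def by (rule hypergeo_1F1_sums[OF b])
  have sums1: "(\<lambda>n. c1 n * z ^ n) sums hypergeo_1F1 a (b + 1) z"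
    unfolding c1_def by (rule hypergeo_1F1_sums[OF b1])
  have "(\<lambda>n. c n * z ^ n - (b - a) / b * (c1 n * z ^ n)) sums
          (hypergeo_1F1 a b z - (b - a) / b * hypergeo_1F1 a (b + 1) z)"
    by (intro sums_diff sums_mult sums sums1)
  hence "(\<lambda>n. diffs c n * z ^ n) sums
           (hypergeo_1F1 a b z - (b - a) / b * hypergeo_1F1 a (b + 1) z)"
    by (simp add: coeff algebra_simps)
  moreover have "((\<lambda>y. \<Sum>n. c n * y ^ n) has_field_derivative (\<Sum>n. diffs c n * z ^ n)) (at z)"
    using sums by (intro termdiffs_strong_converges_everywhere) (blast intro: sums_summable)
  moreover have "(\<lambda>y. \<Sum>n. c n * y ^ n) = hypergeo_1F1 a b"
    using sums by (auto simp: sums_iff)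
  ultimately show ?thesis
    by (simp add: sums_iff)
qed

lemma has_field_derivative_exp_hypergeo_1F1:
  assumes b: "b \<notin> \<int>\<^sub>\<le>\<^sub>0"
  shows "((\<lambda>s. exp s * hypergeo_1F1 a b (x - s)) has_field_derivative
           ((b - a) / b * (exp s * hypergeo_1F1 a (b + 1) (x - s)))) (at s)"
  by (rule derivative_eq_intros DERIV_chain2[OF has_field_derivative_hypergeo_1F1[OF b]] refl)+
     (simp add: algebra_simps diff_divide_distrib)

lemma higher_deriv_exp_hypergeo_1F1:
  assumes b: "b \<notin> \<int>\<^sub>\<le>\<^sub>0"
  shows "(deriv ^^ k) (\<lambda>s. exp s * hypergeo_1F1 a b (x - s)) =
           (\<lambda>s. pochhammer (b - a) k / pochhammer b k *
                  (exp s * hypergeo_1F1 a (b + of_nat k) (x - s)))"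
proof (induction k)
  case 0
  show ?case by simp
next
  case (Suc k)
  have "deriv (\<lambda>s. pochhammer (b - a) k / pochhammer b k *
                  (exp s * hypergeo_1F1 a (b + of_nat k) (x - s))) s =
        pochhammer (b - a) k / pochhammer b k * ((b + of_nat k - a) / (b + of_nat k) *
          (exp s * hypergeo_1F1 a (b + of_nat k + 1) (x - s)))" for s
    by (intro DERIV_imp_deriv DERIV_cmult has_field_derivative_exp_hypergeo_1F1
          nonpos_Ints_plus_of_nat b)
  thus ?case
    by (simp add: Suc.IH pochhammer_Suc fun_eq_iff add_ac diff_add_eq)
qed

text \<open>
  The derivatives of a primitive \<open>G\<close> of \<open>g\<close> are those of \<open>g\<close> one order later, and the integral is the
  value at \<open>w\<close> of the Taylor series of \<open>G\<close> at \<open>z\<close> without its constant term; this accounts for the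
  index \<open>Suc k\<close> in the factorial and the power.
\<close>
lemma entire_contour_integral_linepath_sums:
  assumes g: "g holomorphic_on UNIV"
  shows "g contour_integrable_on linepath z w"
    and "(\<lambda>k. (deriv ^^ k) g z / fact (Suc k) * (w - z) ^ Suc k) sums
           contour_integral (linepath z w) g"
proof -
  obtain G where G: "(G has_field_derivative g s) (at s)" for s
    using holomorphic_convex_primitive'[OF convex_UNIV open_UNIV g] by auto
  have int: "(g has_contour_integral (G w - G z)) (linepath z w)"
    using contour_integral_primitive[of UNIV G g "linepath z w"] G by simp
  show "g contour_integrable_on linepath z w"
    using int by (rule has_contour_integral_integrable)
  have "G holomorphic_on ball z (dist z w + 1)"
    using G by (meson holomorphic_onI field_differentiable_def field_differentiable_at_within)
  hence "(\<lambda>n. (deriv ^^ n) G z / fact n * (w - z) ^ n) sums G w"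
    by (rule holomorphic_power_series) simp
  hence "(\<lambda>k. (deriv ^^ Suc k) G z / fact (Suc k) * (w - z) ^ Suc k) sums (G w - G z)"
    by (subst sums_Suc_iff) simp
  moreover have "deriv G = g"
    using G by (auto intro: DERIV_imp_deriv)
  ultimately show "(\<lambda>k. (deriv ^^ k) g z / fact (Suc k) * (w - z) ^ Suc k) sums
                     contour_integral (linepath z w) g"
    using contour_integral_unique[OF int] by (simp add: funpow_Suc_right del: funpow.simps)
qed

theorem theorem4p122:
  fixes a b t x :: complex
  assumes "t \<noteq> 0" and "b \<notin> \<int>\<^sub>\<le>\<^sub>0"
  shows "(\<lambda>s. exp s * hypergeo_1F1 a b (x - s)) contour_integrable_on linepath 0 t \<and>
    (\<lambda>k. pochhammer (b - a) k * t ^ k * hypergeo_1F1 a (b + of_nat k) x /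
           (fact (k + 1) * pochhammer b k)) sums
      (1 / t * contour_integral (linepath 0 t) (\<lambda>s. exp s * hypergeo_1F1 a b (x - s)))"
proof -
  let ?g = "\<lambda>s. exp s * hypergeo_1F1 a b (x - s)"
  have g: "?g holomorphic_on UNIV"
    using has_field_derivative_exp_hypergeo_1F1[OF assms(2)]
    by (auto simp: holomorphic_on_open)
  have "(\<lambda>k. 1 / t * ((deriv ^^ k) ?g 0 / fact (Suc k) * (t - 0) ^ Suc k)) sums
          (1 / t * contour_integral (linepath 0 t) ?g)"
    by (intro sums_mult entire_contour_integral_linepath_sums g)
  also have "(\<lambda>k. 1 / t * ((deriv ^^ k) ?g 0 / fact (Suc k) * (t - 0) ^ Suc k)) =
    (\<lambda>k. pochhammer (b - a) k * t ^ k * hypergeo_1F1 a (b + of_nat k) x /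
           (fact (k + 1) * pochhammer b k))"
    using assms(1)
    by (simp add: higher_deriv_exp_hypergeo_1F1[OF assms(2)] fun_eq_iff mult_ac del: fact_Suc)
  finally show ?thesis
    using entire_contour_integral_linepath_sums(1)[OF g] by blast
qed

end
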